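(* Let $(X,\mathcal P(A),C+\rho\Omega,P)$ be a regularized model (as described in the context), and suppose that the minorization/drift assumption and the Lipschitz assumption hold. Then: 1. For any terminal Q-function $Q_{\mathrm{terminal}}\in\mathcal C_\alpha$ there exists an average-cost TRMFE with terminal condition $Q_{\mathrm{terminal}}$. 2. Suppose that for any given $Q_{\mathrm{terminal}}\in\mathcal C_\alpha$ there exists a unique average-cost TRMFE with terminal condition $Q_{\mathrm{terminal}}$. If $Q^T_{\mathrm{terminal}}\in\mathcal C_\alpha$, $Q^T_{\mathrm{terminal}}\to Q_{\mathrm{terminal}}$ in $\mathcal C_\alpha$ as $T\to\infty$, and, for each $T$, $(\pi^T_{-t},\mu^T_{-t})_{t=0}^T$ is a finite-horizon average-cost MFE with terminal Q-function $Q^T_{\mathrm{terminal}}$, started from a fixed initial measure $\mu_{\mathrm{init}}\in\mathcal P(X)$, then every accumulation point, as $T\to\infty$, of $(\pi^T_{-t}\otimes\mu^T_{-t})_{t=0}^T$ (extended to times $-t$ with $t>T$ by an arbitrary fixed $\nu\in\mathcal P(X\times\mathcal P(A))$) in $\prod_{t=0}^\infty\mathcal P(X\times\mathcal P(A))$, with the product topology and each factor endowed with weak convergence, induces an average-cost TRMFE with terminal condition $Q_{\mathrm{terminal}}$, i.e. is of the form $(\pi_{-t}\otimes\mu_{-t})_{t=0}^\infty$ for such a TRMFE $(\pi_{-t},\mu_{-t})_{t=0}^\infty$.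
   Context: Setting. $X$ and $A$ are finite nonempty sets with the discrete metric; $\mathcal P(E)$ is the set of probability measures on $E$; $\mathcal P(X)$, $\mathcal P(A)$ carry the norm $\|\cdot\|_1$. $c:X\times A\times\mathcal P(X)\to[0,\infty)$ is a cost function and $p:X\times A\times\mathcal P(X)\to\mathcal P(X)$ a transition kernel. For $u\in\mathcal P(A)$ put $C(x,u,\mu)=\sum_{a}c(x,a,\mu)u(a)$ and $P(\cdot\mid x,u,\mu)=\sum_a p(\cdot\mid x,a,\mu)u(a)$. $\rho>0$ and $\Omega:\mathcal P(A)\to\mathbb R$ is 1-strongly convex for $\|\cdot\|_1$: $\Omega(\theta u+(1-\theta)v)\le\theta\Omega(u)+(1-\theta)\Omega(v)-\frac12\theta(1-\theta)\|u-v\|_1^2$. Minorization/drift assumption. There is a sub-probability measure $\lambda$ on $X$ with $p(\cdot\mid x,a,\mu)\ge\lambda(\cdot)$ for all $x,a,\mu$; and there are $\omega:X\times A\to[1,\infty)$, $\alpha\in(0,1)$ (drift factor), $b\ge0$ with $\sum_{y}\omega_{\max}(y)p(y\mid x,a,\mu)\le\alpha\,\omega(x,a)+b$ for all $x,a,\mu$, where $\omega_{\max}(x)=\max_a\omega(x,a)$. By convention ($\alpha$ being adjusted if necessary), $\sum_x\omega_{\max}(x)\lambda(x)=b$. Put $\tilde p(\cdot\mid x,a,\mu)=p(\cdot\mid x,a,\mu)-\lambda(\cdot)$ and $\tilde P(\cdot\mid x,u,\mu)=\sum_a\tilde p(\cdot\mid x,a,\mu)u(a)$. Lipschitz assumption.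 There are constants $L_1,K_1$ such that for all $x,\hat x,a,\hat a,\mu,\hat\mu$: $|c(x,a,\mu)-c(\hat x,\hat a,\hat\mu)|\le L_1(1_{\{x\ne\hat x\}}+2\cdot 1_{\{a\ne\hat a\}}+\|\mu-\hat\mu\|_1)$ and $\|p(\cdot|x,a,\mu)-p(\cdot|\hat x,\hat a,\hat\mu)\|_1\le K_1(1_{\{x\ne\hat x\}}+2\cdot1_{\{a\ne\hat a\}}+\|\mu-\hat\mu\|_1)$. It is understood that $\alpha K_1<2$. Domain. $M:=\sup C$. $\tilde{\mathcal C}_\alpha$ is the set of $\mathfrak q:X\times A\to\mathbb R$ with $\|\mathfrak q\|_\omega:=\sup_{x,a}\frac{|\mathfrak q(x,a)|}{\omega(x,a)}\le\frac{M}{1-\alpha}$ and $|\mathfrak q(x,a)-\mathfrak q(\tilde x,\tilde a)|\le\frac{L_1}{1-K_1\alpha/2}(1_{\{x\ne\tilde x\}}+2\cdot1_{\{a\ne\tilde a\}})$. $\mathcal C_\alpha$ is the set of $Q(x,u)=\sum_a\mathfrak q(x,a)u(a)+\rho\Omega(u)$ with $\mathfrak q\in\tilde{\mathcal C}_\alpha$, with the norm $\|Q\|=\sup_{x,u}|Q(x,u)|/\tilde\omega(x,u)$, $\tilde\omega(x,u)=\sum_a\omega(x,a)u(a)$. Q-functions are functions $Q:X\times\mathcal P(A)\to\mathbb R$; those of the form (affine in $u$) $+\rho\Omega(u)$ are taken to have, for each $x$, a unique minimizer of $Q(x,\cdot)$. A policy is a kernel $\pi:X\to\mathcal P(\mathcal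 P(A))$; $\pi\otimes\mu$ denotes $\pi(du\mid x)\mu(dx)$. Operators: $$H_1^{\mathrm{avg}}(Q,\mu)(x,u)=C(x,u,\mu)+\rho\Omega(u)+\sum_{y\in X}\min_{v\in\mathcal P(A)}Q(y,v)\,\tilde P(y\mid x,u,\mu),$$ $$H_2(\pi,\mu)(\cdot)=\sum_{x\in X}\int_{\mathcal P(A)}P(\cdot\mid x,u,\mu)\,\pi(du\mid x)\,\mu(x).$$ Average-cost TRMFE with terminal condition $Q_{\mathrm{terminal}}$: a family $(\pi_{-t},\mu_{-t})_{t=0}^\infty$ for which there are Q-functions $(Q_{-t})_{t\ge0}$ with $Q_0=Q_{\mathrm{terminal}}$, $Q_{-t-1}=H_1^{\mathrm{avg}}(Q_{-t},\mu_{-t-1})$, $\mu_{-t}=H_2(\pi_{-t-1},\mu_{-t-1})$ for $t\ge0$, and $\pi_{-t}(\cdot\mid x)$ supported on the minimizers of $Q_{-t}(x,\cdot)$ for all $t\ge0$, $x\in X$. Finite-horizon average-cost MFE with horizon $T$, initial measure $\mu_{\mathrm{init}}$ and terminal Q-function $Q_{\mathrm{terminal}}$: a family $(\pi_{-t},\mu_{-t})_{t=0}^T$ with $\mu_{-T}=\mu_{\mathrm{init}}$ for which there are $(Q_{-t})_{t=0}^T$ satisfying the same relations for $0\le t\le T-1$ (support condition for $0\le t\le T$), with $Q_0=Q_{\mathrm{terminal}}$. (The Q-recursion uses the sub-probability kernel $\tilde P$; the state-measure evolution uses $P$.) *)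

theory Defs
  imports "HOL-Probability.Probability"
begin

(* Probability measures on a finite set E are elements of 'e pmf, metrized by the l1 distance
   sum_e |mu e - nu e|, so that borel is the usual Borel sigma-algebra of the simplex. *)

instantiation pmf :: (finite) metric_space
begin

definition dist_pmf :: "'a pmf \<Rightarrow> 'a pmf \<Rightarrow> real" where
  "dist_pmf u v = (\<Sum>a\<in>UNIV. \<bar>pmf u a - pmf v a\<bar>)"

definition uniformity_pmf :: "('a pmf \<times> 'a pmf) filter" where
  "uniformity_pmf = (INF e\<in>{0<..}. principal {(u, v). dist u v < e})"

definition open_pmf :: "'a pmf set \<Rightarrow> bool" where
  "open_pmf U \<longleftrightarrow> (\<forall>u\<in>U. eventually (\<lambda>(u', v). u' = u \<longrightarrow> v \<in> U) uniformity)"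

instance
proof
  show "dist u v = 0 \<longleftrightarrow> u = v" for u v :: "'a pmf"
  proof
    assume "dist u v = 0"
    then have "\<forall>a\<in>UNIV. \<bar>pmf u a - pmf v a\<bar> = 0"
      unfolding dist_pmf_def by (subst (asm) sum_nonneg_eq_0_iff) auto
    then show "u = v" by (intro pmf_eqI) simp
  qed (simp add: dist_pmf_def)
  show "dist u v \<le> dist u w + dist v w" for u v w :: "'a pmf"
    unfolding dist_pmf_def sum.distrib [symmetric] by (intro sum_mono) linarith
qed (fact uniformity_pmf_def open_pmf_def)+

end

definition avg_cost :: "('x::finite \<Rightarrow> 'a::finite \<Rightarrow> 'x pmf \<Rightarrow> real) \<Rightarrow> 'x \<Rightarrow> 'a pmf \<Rightarrow> 'x pmf \<Rightarrow> real" where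
  "avg_cost c x u \<mu> = (\<Sum>a\<in>UNIV. c x a \<mu> * pmf u a)"

definition avg_kernel ::
  "('x::finite \<Rightarrow> 'a::finite \<Rightarrow> 'x pmf \<Rightarrow> 'x pmf) \<Rightarrow> 'x \<Rightarrow> 'a pmf \<Rightarrow> 'x pmf \<Rightarrow> 'x \<Rightarrow> real" where
  "avg_kernel p x u \<mu> y = (\<Sum>a\<in>UNIV. pmf (p x a \<mu>) y * pmf u a)"

definition avg_subkernel ::
  "('x::finite \<Rightarrow> 'a::finite \<Rightarrow> 'x pmf \<Rightarrow> 'x pmf) \<Rightarrow> ('x \<Rightarrow> real) \<Rightarrow>
   'x \<Rightarrow> 'a pmf \<Rightarrow> 'x pmf \<Rightarrow> 'x \<Rightarrow> real" where
  "avg_subkernel p lam x u \<mu> y = (\<Sum>a\<in>UNIV. (pmf (p x a \<mu>) y - lam y) * pmf u a)"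

definition minimizers :: "('a pmf \<Rightarrow> real) \<Rightarrow> 'a pmf set" where
  "minimizers f = {u. \<forall>v. f u \<le> f v}"

definition strongly_convex_l1 :: "('a::finite pmf \<Rightarrow> real) \<Rightarrow> bool" where
  "strongly_convex_l1 \<Omega> \<longleftrightarrow>
     (\<forall>u v w. \<forall>\<theta>\<in>{0..1}. (\<forall>a. pmf w a = \<theta> * pmf u a + (1 - \<theta>) * pmf v a) \<longrightarrow>
        \<Omega> w \<le> \<theta> * \<Omega> u + (1 - \<theta>) * \<Omega> v - 1/2 * \<theta> * (1 - \<theta>) * (dist u v)\<^sup>2)"

definition reg_Q :: "real \<Rightarrow> ('a::finite pmf \<Rightarrow> real) \<Rightarrow> ('x \<Rightarrow> 'a \<Rightarrow> real) \<Rightarrow> 'x \<Rightarrow> 'a pmf \<Rightarrow> real" where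
  "reg_Q \<rho> \<Omega> q x u = (\<Sum>a\<in>UNIV. q x a * pmf u a) + \<rho> * \<Omega> u"

(* Strong convexity gives uniqueness of minimizers of (affine) + rho * Omega, but not existence:
   Omega need not be lower semicontinuous at the boundary of the simplex. Existence is a standing
   assumption, stated in the last conjunct. On the simplex every affine function is linear. *)

definition regularized_model ::
  "('x::finite \<Rightarrow> 'a::finite \<Rightarrow> 'x pmf \<Rightarrow> real) \<Rightarrow> real \<Rightarrow> ('a pmf \<Rightarrow> real) \<Rightarrow> bool" where
  "regularized_model c \<rho> \<Omega> \<longleftrightarrow>
     (\<forall>x a \<mu>. 0 \<le> c x a \<mu>) \<and> 0 < \<rho> \<and> strongly_convex_l1 \<Omega> \<and>
     (\<forall>l :: 'a \<Rightarrow> real. \<exists>!u. u \<in> minimizers (\<lambda>v. (\<Sum>a\<in>UNIV. l a * pmf v a) + \<rho> * \<Omega> v))"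

definition omega_max :: "('x \<Rightarrow> 'a::finite \<Rightarrow> real) \<Rightarrow> 'x \<Rightarrow> real" where
  "omega_max \<omega> x = Max (range (\<omega> x))"

definition minorization_drift ::
  "('x::finite \<Rightarrow> 'a::finite \<Rightarrow> 'x pmf \<Rightarrow> 'x pmf) \<Rightarrow> ('x \<Rightarrow> real) \<Rightarrow> ('x \<Rightarrow> 'a \<Rightarrow> real) \<Rightarrow>
   real \<Rightarrow> real \<Rightarrow> bool" where
  "minorization_drift p lam \<omega> \<alpha> b \<longleftrightarrow>
     (\<forall>y. 0 \<le> lam y) \<and> (\<Sum>y\<in>UNIV. lam y) \<le> 1 \<and>
     (\<forall>x a \<mu> y. lam y \<le> pmf (p x a \<mu>) y) \<and>
     (\<forall>x a. 1 \<le> \<omega> x a) \<and> 0 < \<alpha> \<and> \<alpha> < 1 \<and> 0 \<le> b \<and>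
     (\<forall>x a \<mu>. (\<Sum>y\<in>UNIV. omega_max \<omega> y * pmf (p x a \<mu>) y) \<le> \<alpha> * \<omega> x a + b) \<and>
     (\<Sum>y\<in>UNIV. omega_max \<omega> y * lam y) = b"

definition lipschitz_model ::
  "('x::finite \<Rightarrow> 'a::finite \<Rightarrow> 'x pmf \<Rightarrow> real) \<Rightarrow> ('x \<Rightarrow> 'a \<Rightarrow> 'x pmf \<Rightarrow> 'x pmf) \<Rightarrow>
   real \<Rightarrow> real \<Rightarrow> bool" where
  "lipschitz_model c p L\<^sub>1 K\<^sub>1 \<longleftrightarrow>
     (\<forall>x x' a a' \<mu> \<mu>'.
        \<bar>c x a \<mu> - c x' a' \<mu>'\<bar> \<le> L\<^sub>1 * (of_bool (x \<noteq> x') + 2 * of_bool (a \<noteq> a') + dist \<mu> \<mu>')) \<and>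
     (\<forall>x x' a a' \<mu> \<mu>'.
        dist (p x a \<mu>) (p x' a' \<mu>') \<le> K\<^sub>1 * (of_bool (x \<noteq> x') + 2 * of_bool (a \<noteq> a') + dist \<mu> \<mu>'))"

definition cost_sup :: "('x::finite \<Rightarrow> 'a::finite \<Rightarrow> 'x pmf \<Rightarrow> real) \<Rightarrow> real" where
  "cost_sup c = (SUP (x, u, \<mu>)\<in>UNIV. avg_cost c x u \<mu>)"

definition omega_norm :: "('x::finite \<Rightarrow> 'a::finite \<Rightarrow> real) \<Rightarrow> ('x \<Rightarrow> 'a \<Rightarrow> real) \<Rightarrow> real" where
  "omega_norm \<omega> q = (SUP (x, a)\<in>UNIV. \<bar>q x a\<bar> / \<omega> x a)"

definition C_tilde ::
  "('x::finite \<Rightarrow> 'a::finite \<Rightarrow> 'x pmf \<Rightarrow> real) \<Rightarrow> ('x \<Rightarrow> 'a \<Rightarrow> real) \<Rightarrow> real \<Rightarrow> real \<Rightarrow> real \<Rightarrow>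
   ('x \<Rightarrow> 'a \<Rightarrow> real) set" where
  "C_tilde c \<omega> \<alpha> L\<^sub>1 K\<^sub>1 =
     {q. omega_norm \<omega> q \<le> cost_sup c / (1 - \<alpha>) \<and>
         (\<forall>x x' a a'. \<bar>q x a - q x' a'\<bar> \<le>
            L\<^sub>1 / (1 - K\<^sub>1 * \<alpha> / 2) * (of_bool (x \<noteq> x') + 2 * of_bool (a \<noteq> a')))}"

definition C_alpha ::
  "('x::finite \<Rightarrow> 'a::finite \<Rightarrow> 'x pmf \<Rightarrow> real) \<Rightarrow> real \<Rightarrow> ('a pmf \<Rightarrow> real) \<Rightarrow> ('x \<Rightarrow> 'a \<Rightarrow> real) \<Rightarrow>
   real \<Rightarrow> real \<Rightarrow> real \<Rightarrow> ('x \<Rightarrow> 'a pmf \<Rightarrow> real) set" where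
  "C_alpha c \<rho> \<Omega> \<omega> \<alpha> L\<^sub>1 K\<^sub>1 = reg_Q \<rho> \<Omega> ` C_tilde c \<omega> \<alpha> L\<^sub>1 K\<^sub>1"

definition Q_norm :: "('x::finite \<Rightarrow> 'a::finite \<Rightarrow> real) \<Rightarrow> ('x \<Rightarrow> 'a pmf \<Rightarrow> real) \<Rightarrow> real" where
  "Q_norm \<omega> Q = (SUP (x, u)\<in>UNIV. \<bar>Q x u\<bar> / (\<Sum>a\<in>UNIV. \<omega> x a * pmf u a))"

(* In the recursion Q is always of the form (affine) + rho * Omega, so in a regularized model the
   infimum over v is an attained minimum. *)

definition H1_avg ::
  "('x::finite \<Rightarrow> 'a::finite \<Rightarrow> 'x pmf \<Rightarrow> real) \<Rightarrow> ('x \<Rightarrow> 'a \<Rightarrow> 'x pmf \<Rightarrow> 'x pmf) \<Rightarrow> ('x \<Rightarrow> real) \<Rightarrow>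
   real \<Rightarrow> ('a pmf \<Rightarrow> real) \<Rightarrow> ('x \<Rightarrow> 'a pmf \<Rightarrow> real) \<Rightarrow> 'x pmf \<Rightarrow> 'x \<Rightarrow> 'a pmf \<Rightarrow> real" where
  "H1_avg c p lam \<rho> \<Omega> Q \<mu> x u =
     avg_cost c x u \<mu> + \<rho> * \<Omega> u + (\<Sum>y\<in>UNIV. (INF v. Q y v) * avg_subkernel p lam x u \<mu> y)"

definition H2 ::
  "('x::finite \<Rightarrow> 'a::finite \<Rightarrow> 'x pmf \<Rightarrow> 'x pmf) \<Rightarrow> ('x \<Rightarrow> 'a pmf measure) \<Rightarrow> 'x pmf \<Rightarrow> 'x \<Rightarrow> real" where
  "H2 p \<pi> \<mu> y = (\<Sum>x\<in>UNIV. (\<integral>u. avg_kernel p x u \<mu> y \<partial>\<pi> x) * pmf \<mu> x)"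

definition policy :: "('x \<Rightarrow> 'a::finite pmf measure) \<Rightarrow> bool" where
  "policy \<pi> \<longleftrightarrow> (\<forall>x. \<pi> x \<in> space (prob_algebra borel))"

(* In the following families, index t stands for time -t. *)

definition avg_TRMFE ::
  "('x::finite \<Rightarrow> 'a::finite \<Rightarrow> 'x pmf \<Rightarrow> real) \<Rightarrow> ('x \<Rightarrow> 'a \<Rightarrow> 'x pmf \<Rightarrow> 'x pmf) \<Rightarrow> ('x \<Rightarrow> real) \<Rightarrow>
   real \<Rightarrow> ('a pmf \<Rightarrow> real) \<Rightarrow> ('x \<Rightarrow> 'a pmf \<Rightarrow> real) \<Rightarrow>
   (nat \<Rightarrow> 'x \<Rightarrow> 'a pmf measure) \<Rightarrow> (nat \<Rightarrow> 'x pmf) \<Rightarrow> bool" where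
  "avg_TRMFE c p lam \<rho> \<Omega> Qterm \<pi> \<mu> \<longleftrightarrow>
     (\<forall>t. policy (\<pi> t)) \<and>
     (\<exists>Q. Q 0 = Qterm \<and>
        (\<forall>t. Q (Suc t) = H1_avg c p lam \<rho> \<Omega> (Q t) (\<mu> (Suc t))) \<and>
        (\<forall>t. pmf (\<mu> t) = H2 p (\<pi> (Suc t)) (\<mu> (Suc t))) \<and>
        (\<forall>t x. AE u in \<pi> t x. u \<in> minimizers (Q t x)))"

definition avg_finite_MFE ::
  "('x::finite \<Rightarrow> 'a::finite \<Rightarrow> 'x pmf \<Rightarrow> real) \<Rightarrow> ('x \<Rightarrow> 'a \<Rightarrow> 'x pmf \<Rightarrow> 'x pmf) \<Rightarrow> ('x \<Rightarrow> real) \<Rightarrow>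
   real \<Rightarrow> ('a pmf \<Rightarrow> real) \<Rightarrow> nat \<Rightarrow> 'x pmf \<Rightarrow> ('x \<Rightarrow> 'a pmf \<Rightarrow> real) \<Rightarrow>
   (nat \<Rightarrow> 'x \<Rightarrow> 'a pmf measure) \<Rightarrow> (nat \<Rightarrow> 'x pmf) \<Rightarrow> bool" where
  "avg_finite_MFE c p lam \<rho> \<Omega> T \<mu>init Qterm \<pi> \<mu> \<longleftrightarrow>
     (\<forall>t\<le>T. policy (\<pi> t)) \<and> \<mu> T = \<mu>init \<and>
     (\<exists>Q. Q 0 = Qterm \<and>
        (\<forall>t<T. Q (Suc t) = H1_avg c p lam \<rho> \<Omega> (Q t) (\<mu> (Suc t))) \<and>
        (\<forall>t<T. pmf (\<mu> t) = H2 p (\<pi> (Suc t)) (\<mu> (Suc t))) \<and>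
        (\<forall>t\<le>T. \<forall>x. AE u in \<pi> t x. u \<in> minimizers (Q t x)))"

(* As X is finite and discrete, this is the Borel sigma-algebra of X x P(A). *)

abbreviation state_control_space :: "('x::finite \<times> 'a::finite pmf) measure" where
  "state_control_space \<equiv> count_space UNIV \<Otimes>\<^sub>M borel"

definition policy_prod :: "('x::finite \<Rightarrow> 'a::finite pmf measure) \<Rightarrow> 'x pmf \<Rightarrow> ('x \<times> 'a pmf) measure" where
  "policy_prod \<pi> \<mu> = measure_pmf \<mu> \<bind> (\<lambda>x. distr (\<pi> x) state_control_space (Pair x))"

definition weak_topology :: "('x::finite \<times> 'a::finite pmf) measure topology" where
  "weak_topology = topology_generated_by
     {{N \<in> space (prob_algebra state_control_space). (\<integral>z. f z \<partial>N) \<in> U} | f (U :: real set).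
        continuous_map (prod_topology (discrete_topology UNIV) euclidean) euclideanreal f \<and>
        bounded (range f) \<and> open U}"

definition accumulation_point :: "'b topology \<Rightarrow> (nat \<Rightarrow> 'b) \<Rightarrow> 'b \<Rightarrow> bool" where
  "accumulation_point \<T> s z \<longleftrightarrow>
     z \<in> topspace \<T> \<and> (\<forall>U. openin \<T> U \<and> z \<in> U \<longrightarrow> (\<exists>\<^sub>F n in sequentially. s n \<in> U))"

end

theory Submission
  imports Defs
begin

text \<open>
  Strong convexity makes the minimizer of \<open>l \<bullet> u + \<rho> * \<Omega> u\<close> a continuous function of \<open>l\<close>, and the
  optimal value is Lipschitz in \<open>l\<close>. Hence, for a fixed terminal Q-function, \<open>Q\<^sub>-\<^sub>t\<close> and its greedy
  controls are continuous functions of \<open>\<mu>\<^sub>-\<^sub>1, \<dots>, \<mu>\<^sub>-\<^sub>t\<close>, and a TRMFE is exactly a fixed point of the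
  continuous self-map of the countable product of simplices that sends \<open>(\<mu>\<^sub>-\<^sub>t)\<close> to the
  sequence with entries \<open>H\<^sub>2(\<pi>\<^sub>-\<^sub>t\<^sub>-\<^sub>1, \<mu>\<^sub>-\<^sub>t\<^sub>-\<^sub>1)\<close>. Such a fixed point exists because the Hilbert cube
  has the fixed point property: Kuhn's combinatorial lemma in the first \<open>m\<close> coordinates, with mesh \<open>1/m\<close>,
  produces approximate fixed points, and these accumulate at a fixed point by compactness.

  For the second claim, near an accumulation point the state marginals converge, hence so do the
  Q-functions and controls; the limiting measures are therefore supported on the graphs of the limiting
  controls, and the equilibrium relations pass to the limit.
\<close>

section \<open>A fixed point theorem for sequences of probability vectors\<close>

lemma tendsto_fun_iff:
  fixes f :: "'b \<Rightarrow> 'i \<Rightarrow> 'c::topological_space"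
  shows "(f \<longlongrightarrow> l) F \<longleftrightarrow> (\<forall>i. ((\<lambda>n. f n i) \<longlongrightarrow> l i) F)"
  using limitin_componentwise[of "\<lambda>_. euclidean" UNIV f l F]
  by (simp add: euclidean_product_topology)

section \<open>The fixed point property of the Hilbert cube\<close>

definition hilbert_cube :: "(nat \<Rightarrow> real) set" where
  "hilbert_cube = {x. \<forall>i. 0 \<le> x i \<and> x i \<le> 1}"

lemma compact_hilbert_cube: "compact hilbert_cube"
proof -
  have "compactin (product_topology (\<lambda>_. euclidean) UNIV) (PiE UNIV (\<lambda>_::nat. {0..1::real}))"
    by (subst compactin_PiE) auto
  moreover have "PiE UNIV (\<lambda>_. {0..1}) = hilbert_cube"
    by (auto simp: hilbert_cube_def PiE_iff)
  ultimately show ?thesis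
    by (simp add: euclidean_product_topology)
qed

text \<open>Label a grid point in direction \<open>i\<close> by whether \<open>F\<close> moves
  coordinate \<open>i\<close> up or down. Kuhn's lemma yields a cell in which every label takes both
  values; \<open>z\<close> is its scaled corner, and the vertices \<open>r\<close>, \<open>s\<close>
  may depend on \<open>i\<close>.\<close>

lemma kuhn_hilbert_cube:
  fixes F :: "(nat \<Rightarrow> real) \<Rightarrow> nat \<Rightarrow> real"
  assumes F: "F \<in> hilbert_cube \<rightarrow> hilbert_cube" and m: "0 < m"
  shows "\<exists>z\<in>hilbert_cube. \<forall>i<m. \<exists>r s. r \<in> hilbert_cube \<and> s \<in> hilbert_cube \<and>
    r i \<le> F r i \<and> F s i \<le> s i \<and>
    (\<forall>j<m. \<bar>r j - z j\<bar> \<le> 1 / real m \<and> \<bar>s j - z j\<bar> \<le> 1 / real m)"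
proof -
  define sc where "sc x i = (if i < m then real (x i) / real m else 0)" for x :: "nat \<Rightarrow> nat" and i
  have sc: "sc x \<in> hilbert_cube" if "\<forall>i<m. x i \<le> m" for x
    using that m by (auto simp: sc_def hilbert_cube_def)
  have F01: "0 \<le> F (sc x) i" "F (sc x) i \<le> 1" if "\<forall>i<m. x i \<le> m" for x i
    using F sc[OF that] by (auto simp: Pi_iff hilbert_cube_def)
  \<comment> \<open>Kuhn's lemma wants label 1 on each upper face, hence the clause
    \<open>x i \<noteq> m\<close>. There the label still means
    \<open>F (sc x) i \<le> sc x i\<close>, because \<open>sc x i = 1\<close>.\<close>
  define lab where "lab x i = (if sc x i \<le> F (sc x) i \<and> x i \<noteq> m then 0 else 1::nat)" for x i
  have lab0: "sc x i \<le> F (sc x) i" if "lab x i = 0" for x i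
    using that by (auto simp: lab_def split: if_splits)
  have lab1: "F (sc x) i \<le> sc x i" if "lab x i \<noteq> 0" "\<forall>i<m. x i \<le> m" "i < m" for x i
    using that F01(2)[of x i] by (auto simp: lab_def sc_def split: if_splits)
  obtain q where q: "\<forall>i<m. q i < m"
    and rs: "\<forall>i<m. \<exists>r s. (\<forall>j<m. q j \<le> r j \<and> r j \<le> q j + 1)
      \<and> (\<forall>j<m. q j \<le> s j \<and> s j \<le> q j + 1) \<and> lab r i \<noteq> lab s i"
  proof (rule kuhn_lemma[OF m, of m lab])
    show "\<forall>x. (\<forall>i<m. x i \<le> m) \<longrightarrow> (\<forall>i<m. x i = 0 \<longrightarrow> lab x i = 0)"
      using F01(1) m by (auto simp: lab_def sc_def)
  qed (auto simp: lab_def)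
  have "\<forall>i<m. \<exists>r s. r \<in> hilbert_cube \<and> s \<in> hilbert_cube \<and> r i \<le> F r i \<and> F s i \<le> s i \<and>
        (\<forall>j<m. \<bar>r j - sc q j\<bar> \<le> 1 / real m \<and> \<bar>s j - sc q j\<bar> \<le> 1 / real m)"
  proof (intro allI impI)
    fix i assume i: "i < m"
    have near: "\<bar>sc r j - sc q j\<bar> \<le> 1 / real m"
      if "\<forall>j<m. q j \<le> r j \<and> r j \<le> q j + 1" "j < m" for r j
    proof -
      have "sc r j - sc q j = (real (r j) - real (q j)) / real m"
        using that by (simp add: sc_def diff_divide_distrib)
      moreover have "\<bar>real (r j) - real (q j)\<bar> \<le> 1"
        using that(1)[rule_format, OF that(2)] by linarith
      ultimately show ?thesis
        using m by (simp add: abs_divide divide_right_mono)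
    qed
    have bd: "\<forall>j<m. r j \<le> m" if "\<forall>j<m. q j \<le> r j \<and> r j \<le> q j + 1" for r
      proof (intro allI impI)
      fix j assume "j < m"
      then show "r j \<le> m" using that[rule_format, of j] q[rule_format, of j] by linarith
    qed
    \<comment> \<open>The labels at \<open>r\<close> and \<open>s\<close> merely differ; being 0 or
      1, they can be put in this order by swapping the vertices.\<close>
    have "\<exists>r s. (\<forall>j<m. q j \<le> r j \<and> r j \<le> q j + 1)
      \<and> (\<forall>j<m. q j \<le> s j \<and> s j \<le> q j + 1) \<and> lab r i = 0 \<and> lab s i \<noteq> 0"
      using rs[rule_format, OF i] by (metis lab_def)
    then obtain r s where r: "\<forall>j<m. q j \<le> r j \<and> r j \<le> q j + 1"
      and s: "\<forall>j<m. q j \<le> s j \<and> s j \<le> q j + 1" and "lab r i = 0" "lab s i \<noteq> 0"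
      by blast
    then show "\<exists>r s. r \<in> hilbert_cube \<and> s \<in> hilbert_cube \<and> r i \<le> F r i \<and> F s i \<le> s i \<and>
        (\<forall>j<m. \<bar>r j - sc q j\<bar> \<le> 1 / real m \<and> \<bar>s j - sc q j\<bar> \<le> 1 / real m)"
      using lab0 lab1 near sc bd i
      by (intro exI[of _ "sc r"] exI[of _ "sc s"]) auto
  qed
  moreover have "sc q \<in> hilbert_cube"
    using q by (intro sc) (auto simp: less_imp_le)
  ultimately show ?thesis by blast
qed

text \<open>A subsequence of the cell corners converges by compactness. For fixed \<open>i\<close>
  the vertices \<open>r\<close> and \<open>s\<close> tend to the same limit in every coordinate,
  where \<open>r i \<le> F r i\<close> and \<open>F s i \<le> s i\<close> turn into opposite
  inequalities.\<close>

lemma hilbert_cube_fixpoint: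
  fixes F :: "(nat \<Rightarrow> real) \<Rightarrow> nat \<Rightarrow> real"
  assumes cont: "continuous_on hilbert_cube F" and F: "F \<in> hilbert_cube \<rightarrow> hilbert_cube"
  shows "\<exists>x\<in>hilbert_cube. F x = x"
proof -
  define P where "P n z i r s \<longleftrightarrow> r \<in> hilbert_cube \<and> s \<in> hilbert_cube \<and> r i \<le> F r i \<and> F s i \<le> s i \<and>
    (\<forall>j<Suc n. \<bar>r j - z j\<bar> \<le> 1 / real (Suc n) \<and> \<bar>s j - z j\<bar> \<le> 1 / real (Suc n))"
    for n and z :: "nat \<Rightarrow> real" and i r s
  have "\<forall>n. \<exists>z\<in>hilbert_cube. \<forall>i<Suc n. \<exists>r s. P n z i r s"
    unfolding P_def using kuhn_hilbert_cube[OF F zero_less_Suc] by iprover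
  then have "\<forall>n. \<exists>z. z \<in> hilbert_cube \<and> (\<forall>i<Suc n. \<exists>r s. P n z i r s)"
    unfolding Bex_def .
  then obtain z where "\<forall>n. z n \<in> hilbert_cube \<and> (\<forall>i<Suc n. \<exists>r s. P n (z n) i r s)"
    by (rule choice[THEN exE])
  then have z: "\<And>n. z n \<in> hilbert_cube"
    and rs: "\<And>n i. i < Suc n \<Longrightarrow> \<exists>r s. P n (z n) i r s"
    by auto
  obtain l \<phi> where l: "l \<in> hilbert_cube" and \<phi>: "strict_mono \<phi>" and lim: "(z \<circ> \<phi>) \<longlonglongrightarrow> l"
    using compact_imp_seq_compact[OF compact_hilbert_cube] z unfolding seq_compact_def by blast
  \<comment> \<open>The bound is available only once \<open>i\<close> and \<open>j\<close> are both
    below \<open>Suc (\<phi> n)\<close>, which holds from \<open>n = i + j\<close> on.\<close>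
  have conv: "(\<lambda>n. r n j) \<longlonglongrightarrow> l j"
    if "\<And>n. j < Suc (\<phi> n) \<Longrightarrow> i < Suc (\<phi> n) \<Longrightarrow> \<bar>r n j - z (\<phi> n) j\<bar> \<le> 1 / real (Suc (\<phi> n))"
    for r :: "nat \<Rightarrow> nat \<Rightarrow> real" and i j
  proof -
    have null: "(\<lambda>n. 1 / real (Suc (\<phi> n))) \<longlonglongrightarrow> 0"
      using LIMSEQ_subseq_LIMSEQ[OF LIMSEQ_Suc[OF lim_1_over_n] \<phi>] by (simp add: o_def)
    have close: "\<forall>\<^sub>F n in sequentially. norm (r n j - z (\<phi> n) j) \<le> 1 / real (Suc (\<phi> n))"
      using eventually_ge_at_top[of "i + j"]
    proof eventually_elim
      case (elim n)
      then show ?case using that[of n] seq_suble[OF \<phi>, of n] by simp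
    qed
    have "(\<lambda>n. r n j - z (\<phi> n) j) \<longlonglongrightarrow> 0"
      by (rule Lim_null_comparison[OF close null])
    moreover have "(\<lambda>n. z (\<phi> n) j) \<longlonglongrightarrow> l j"
      using lim by (simp add: tendsto_fun_iff o_def)
    ultimately show ?thesis
      using tendsto_add by fastforce
  qed
  have "F l i = l i" for i
  proof -
    \<comment> \<open>For the finitely many \<open>n\<close> with
      \<open>Suc (\<phi> n) \<le> i\<close> there are no vertices; \<open>l\<close> fills in, so
      that \<open>r\<close> and \<open>s\<close> become total sequences in the cube.\<close>
    have "\<exists>r s. r \<in> hilbert_cube \<and> s \<in> hilbert_cube \<and> (i < Suc (\<phi> n) \<longrightarrow> P (\<phi> n) (z (\<phi> n)) i r s)" for n
      using rs[of i "\<phi> n"] l unfolding P_def by blast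
    then obtain r s where r: "\<And>n. r n \<in> hilbert_cube" and s: "\<And>n. s n \<in> hilbert_cube"
      and P: "\<And>n. i < Suc (\<phi> n) \<Longrightarrow> P (\<phi> n) (z (\<phi> n)) i (r n) (s n)"
      by metis
    have *: "r n i \<le> F (r n) i" "F (s n) i \<le> s n i"
      "j < Suc (\<phi> n) \<Longrightarrow> \<bar>r n j - z (\<phi> n) j\<bar> \<le> 1 / real (Suc (\<phi> n))"
      "j < Suc (\<phi> n) \<Longrightarrow> \<bar>s n j - z (\<phi> n) j\<bar> \<le> 1 / real (Suc (\<phi> n))"
      if "i < Suc (\<phi> n)" for n j
      using P[OF that] unfolding P_def by auto
    have rl: "r \<longlonglongrightarrow> l" and sl: "s \<longlonglongrightarrow> l"
      unfolding tendsto_fun_iff using conv[of _ i r] conv[of _ i s] * by blast+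
    have "(\<lambda>n. F (r n)) \<longlonglongrightarrow> F l" "(\<lambda>n. F (s n)) \<longlonglongrightarrow> F l"
      using r s by (auto intro!: continuous_on_tendsto_compose[OF cont _ l] rl sl)
    then have Fr: "(\<lambda>n. F (r n) i) \<longlonglongrightarrow> F l i" and Fs: "(\<lambda>n. F (s n) i) \<longlonglongrightarrow> F l i"
      by (simp_all add: tendsto_fun_iff)
    have ev: "\<forall>\<^sub>F n in sequentially. i < Suc (\<phi> n)"
      using eventually_ge_at_top[of i]
    proof eventually_elim
      case (elim n)
      then show ?case using seq_suble[OF \<phi>, of n] by simp
    qed
    have ri: "(\<lambda>n. r n i) \<longlonglongrightarrow> l i" and si: "(\<lambda>n. s n i) \<longlonglongrightarrow> l i"
      using rl sl by (simp_all add: tendsto_fun_iff)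
    show ?thesis
    proof (rule antisym)
      show "F l i \<le> l i"
        by (rule tendsto_le[OF sequentially_bot si Fs eventually_mono[OF ev *(2)]])
      show "l i \<le> F l i"
        by (rule tendsto_le[OF sequentially_bot Fr ri eventually_mono[OF ev *(1)]])
    qed
  qed
  then show ?thesis using l by blast
qed

section \<open>Sequences of probability vectors as a retract of the cube\<close>

lemma pmf_exists:
  fixes w :: "'x::finite \<Rightarrow> real"
  assumes "\<And>y. 0 \<le> w y" "(\<Sum>y\<in>UNIV. w y) = 1"
  shows "\<exists>\<mu>. \<forall>y. pmf \<mu> y = w y"
proof -
  have "(\<integral>\<^sup>+ y. ennreal (w y) \<partial>count_space UNIV) = 1"
    using assms by (simp add: nn_integral_count_space_finite)
  then show ?thesis
    using pmf_embed_pmf[of w] assms by blast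
qed

lemma tendsto_pmf_iff:
  fixes f :: "'b \<Rightarrow> 'x::finite pmf"
  shows "(f \<longlongrightarrow> \<mu>) F \<longleftrightarrow> (\<forall>y. ((\<lambda>n. pmf (f n) y) \<longlongrightarrow> pmf \<mu> y) F)"
proof
  assume "(f \<longlongrightarrow> \<mu>) F"
  then have lim: "((\<lambda>n. dist (f n) \<mu>) \<longlongrightarrow> 0) F" by (rule tendsto_dist_iff[THEN iffD1])
  have "((\<lambda>n. pmf (f n) y - pmf \<mu> y) \<longlongrightarrow> 0) F" for y
  proof (rule Lim_null_comparison[OF _ lim])
    show "\<forall>\<^sub>F n in F. norm (pmf (f n) y - pmf \<mu> y) \<le> dist (f n) \<mu>"
      unfolding dist_pmf_def real_norm_def by (intro always_eventually allI member_le_sum) auto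
  qed
  then show "\<forall>y. ((\<lambda>n. pmf (f n) y) \<longlongrightarrow> pmf \<mu> y) F"
    by (blast intro: LIM_zero_cancel)
next
  assume *: "\<forall>y. ((\<lambda>n. pmf (f n) y) \<longlongrightarrow> pmf \<mu> y) F"
  have "((\<lambda>n. \<Sum>y\<in>UNIV. \<bar>pmf (f n) y - pmf \<mu> y\<bar>) \<longlongrightarrow> (\<Sum>y\<in>UNIV. \<bar>pmf \<mu> y - pmf \<mu> y\<bar>)) F"
    by (intro tendsto_intros *[rule_format])
  then show "(f \<longlongrightarrow> \<mu>) F"
    by (subst tendsto_dist_iff) (simp add: dist_pmf_def)
qed

text \<open>\<open>dec\<close> reads a point of the cube as a sequence of nonnegative vectors and
  \<open>R\<close> retracts each onto the simplex. Running \<open>G\<close> after these maps and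
  encoding the result gives a self-map of the cube, whose fixed point decodes to one of
  \<open>G\<close>.\<close>

lemma pmf_sequence_fixpoint:
  fixes G :: "(nat \<Rightarrow> 'x::finite pmf) \<Rightarrow> nat \<Rightarrow> 'x pmf"
  assumes "continuous_on UNIV G"
  shows "\<exists>\<mu>. G \<mu> = \<mu>"
proof -
  define S :: "('x \<Rightarrow> real) \<Rightarrow> real" where "S w = (\<Sum>y\<in>UNIV. w y)" for w
  \<comment> \<open>Missing mass is spread evenly, excess mass divided out. Vectors of mass 1 are
    fixed, and the denominator is at least 1, so \<open>W\<close> is continuous even at the zero
    vector, unlike plain normalization.\<close>
  define W where "W w y = (w y + max 0 (1 - S w) / card (UNIV::'x set)) / max 1 (S w)"
    for w :: "'x \<Rightarrow> real" and y
  have "\<exists>\<mu>. \<forall>y. pmf \<mu> y = W w y" if "\<And>y. 0 \<le> w y" for w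
  proof (rule pmf_exists)
    have "0 < max 1 (S w)" by simp
    then show "0 \<le> W w y" for y using that[of y] by (auto simp: W_def intro!: divide_nonneg_pos add_nonneg_nonneg)
    have "(\<Sum>y\<in>UNIV. W w y) = (S w + max 0 (1 - S w)) / max 1 (S w)"
      by (simp add: W_def S_def sum.distrib flip: sum_divide_distrib)
    also have "\<dots> = 1" by (simp add: max_def)
    finally show "(\<Sum>y\<in>UNIV. W w y) = 1" .
  qed
  then obtain R where R: "\<And>w y. (\<And>y. 0 \<le> w y) \<Longrightarrow> pmf (R w) y = W w y"
    by metis
  define dec where "dec x t y = x (to_nat (t, y))" for x :: "nat \<Rightarrow> real" and t :: nat and y :: 'x
  define F where "F x i = (case from_nat i of (t, y) \<Rightarrow> pmf (G (\<lambda>t. R (dec x t)) t) y)" for x i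
  have dec0: "0 \<le> dec x t y" if "x \<in> hilbert_cube" for x t y
    using that by (auto simp: dec_def hilbert_cube_def)
  have "continuous_on hilbert_cube F"
    unfolding continuous_on_def
  proof
    fix x assume x: "x \<in> hilbert_cube"
    let ?F = "at x within hilbert_cube"
    have "((\<lambda>x. x) \<longlongrightarrow> x) ?F" by (rule tendsto_ident_at)
    then have "((\<lambda>x. dec x t y) \<longlongrightarrow> dec x t y) ?F" for t y
      by (simp add: tendsto_fun_iff dec_def)
    then have W: "((\<lambda>x. W (dec x t) y) \<longlongrightarrow> W (dec x t) y) ?F" for t y
      unfolding W_def S_def by (intro tendsto_intros) auto
    have "\<forall>\<^sub>F x in ?F. x \<in> hilbert_cube"
      by (auto simp: eventually_at_filter)
    then have "\<forall>\<^sub>F x in ?F. W (dec x t) y = pmf (R (dec x t)) y" for t y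
      by (rule eventually_mono) (simp add: R dec0)
    then have "((\<lambda>x. pmf (R (dec x t)) y) \<longlongrightarrow> pmf (R (dec x t)) y) ?F" for t y
      using Lim_transform_eventually[OF W] R[of "dec x t" y] dec0[OF x] by auto
    then have "((\<lambda>x t. R (dec x t)) \<longlongrightarrow> (\<lambda>t. R (dec x t))) ?F"
      by (simp add: tendsto_fun_iff[of "\<lambda>x t. R (dec x t)"] tendsto_pmf_iff)
    then have "((\<lambda>x. G (\<lambda>t. R (dec x t))) \<longlongrightarrow> G (\<lambda>t. R (dec x t))) ?F"
      by (intro continuous_on_tendsto_compose[OF assms]) auto
    then have "((\<lambda>x. pmf (G (\<lambda>t. R (dec x t)) t) y) \<longlongrightarrow> pmf (G (\<lambda>t. R (dec x t)) t) y) ?F" for t y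
      unfolding tendsto_fun_iff tendsto_pmf_iff by blast
    then show "(F \<longlongrightarrow> F x) ?F"
      unfolding tendsto_fun_iff F_def by (simp split: prod.split)
  qed
  moreover have "F \<in> hilbert_cube \<rightarrow> hilbert_cube"
    by (simp add: F_def hilbert_cube_def pmf_le_1 split: prod.split)
  ultimately obtain x where x: "x \<in> hilbert_cube" and "F x = x"
    using hilbert_cube_fixpoint by blast
  then have "F x (to_nat (t, y)) = dec x t y" for t y by (simp add: dec_def)
  then have dec: "pmf (G (\<lambda>t. R (dec x t)) t) y = dec x t y" for t y
    by (simp add: F_def)
  have "G (\<lambda>t. R (dec x t)) t = R (dec x t)" for t
  proof (rule pmf_eqI)
    fix y
    \<comment> \<open>The decoded coordinates are masses of a \<open>pmf\<close>, hence already on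
      the simplex, where the retraction is the identity.\<close>
    have "S (dec x t) = 1"
      unfolding S_def by (simp add: sum_pmf_eq_1 flip: dec)
    then show "pmf (G (\<lambda>t. R (dec x t)) t) y = pmf (R (dec x t)) y"
      using dec0[OF x] by (simp add: R dec W_def)
  qed
  then show ?thesis by blast
qed

section \<open>Regularized models\<close>

text \<open>With unique minimizers, this turns the support condition of an equilibrium into an
  equation for the policy.\<close>

lemma prob_AE_eq_return:
  fixes N :: "'b::t1_space measure"
  assumes "N \<in> space (prob_algebra borel)" "AE v in N. v = u"
  shows "N = return borel u"
  using assms prob_space.AE_eq_constD(1)[of N u] return_cong[of N borel u]
  by (auto simp: space_prob_algebra)

lemma return_mem_prob_algebra: "return borel u \<in> space (prob_algebra borel)"
  by (simp add: space_prob_algebra prob_space_return)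

lemma continuous_on_pmf: "continuous_on UNIV (\<lambda>u :: 'a::finite pmf. pmf u a)"
  unfolding continuous_on_def
proof
  fix u :: "'a pmf"
  show "((\<lambda>v. pmf v a) \<longlongrightarrow> pmf u a) (at u)"
    using tendsto_ident_at[of u UNIV] unfolding tendsto_pmf_iff by blast
qed

lemma pmf_bind_finite:
  fixes \<mu> :: "'x::finite pmf"
  shows "pmf (bind_pmf \<mu> f) y = (\<Sum>x\<in>UNIV. pmf (f x) y * pmf \<mu> x)"
  by (subst pmf_bind, subst integral_measure_pmf_real[of UNIV]) auto

lemma tendsto_sum_abs_diff:
  fixes ls :: "'b \<Rightarrow> 'i::finite \<Rightarrow> real"
  assumes "\<And>a. ((\<lambda>n. ls n a) \<longlongrightarrow> l a) F"
  shows "((\<lambda>n. \<Sum>a\<in>UNIV. \<bar>ls n a - l a\<bar>) \<longlongrightarrow> 0) F"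
proof -
  have "((\<lambda>n. \<Sum>a\<in>UNIV. \<bar>ls n a - l a\<bar>) \<longlongrightarrow> (\<Sum>a\<in>UNIV. \<bar>l a - l a\<bar>)) F"
    by (intro tendsto_intros assms)
  then show ?thesis by simp
qed

locale regularized_mfg =
  fixes c :: "'x::finite \<Rightarrow> 'a::finite \<Rightarrow> 'x pmf \<Rightarrow> real"
    and p :: "'x \<Rightarrow> 'a \<Rightarrow> 'x pmf \<Rightarrow> 'x pmf"
    and lam :: "'x \<Rightarrow> real" and \<rho> :: real and \<Omega> :: "'a pmf \<Rightarrow> real"
    and L\<^sub>1 K\<^sub>1 :: real
  assumes model: "regularized_model c \<rho> \<Omega>"
    and lipschitz: "lipschitz_model c p L\<^sub>1 K\<^sub>1"
begin

lemma rho_pos: "0 < \<rho>"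
  using model by (simp add: regularized_model_def)

section \<open>Stability of the regularized minimizer and its value\<close>

definition reg_val :: "('a \<Rightarrow> real) \<Rightarrow> 'a pmf \<Rightarrow> real" where
  "reg_val l u = (\<Sum>a\<in>UNIV. l a * pmf u a) + \<rho> * \<Omega> u"

definition response :: "('a \<Rightarrow> real) \<Rightarrow> 'a pmf" where
  "response l = (THE u. u \<in> minimizers (reg_val l))"

lemma minimizers_reg_val: "minimizers (reg_val l) = {response l}"
proof -
  have "\<exists>!u. u \<in> minimizers (reg_val l)"
    using model by (simp add: regularized_model_def reg_val_def[abs_def])
  then show ?thesis
    unfolding response_def by (auto intro: theI' the1_equality[symmetric])
qed

lemma reg_val_response_le: "reg_val l (response l) \<le> reg_val l v"
  using minimizers_reg_val[of l] by (auto simp: minimizers_def)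

lemma INF_reg_val: "(INF v. reg_val l v) = reg_val l (response l)"
  by (rule cInf_eq_minimum) (auto simp: reg_val_response_le)

text \<open>Strong convexity at the midpoint of \<open>v\<close> and the minimizer.\<close>

lemma reg_val_quadratic_growth:
  "reg_val l (response l) + \<rho> / 4 * (dist v (response l))\<^sup>2 \<le> reg_val l v"
proof -
  let ?u = "response l"
  have "\<exists>w. \<forall>a. pmf w a = (1/2) * pmf ?u a + (1 - 1/2) * pmf v a"
    by (rule pmf_exists) (auto simp: sum.distrib sum_pmf_eq_1 simp flip: sum_divide_distrib)
  then obtain w where w: "\<forall>a. pmf w a = (1/2) * pmf ?u a + (1 - 1/2) * pmf v a" ..
  then have "\<Omega> w \<le> (1/2) * \<Omega> ?u + (1 - 1/2) * \<Omega> v - 1/2 * (1/2) * (1 - 1/2) * (dist ?u v)\<^sup>2"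
    using model[unfolded regularized_model_def strongly_convex_l1_def]
    by (elim conjE allE[of _ ?u] allE[of _ v] allE[of _ w]) (drule bspec[of _ _ "1/2"]; simp)
  then have "\<rho> * \<Omega> w \<le> \<rho> * ((1/2) * \<Omega> ?u + (1/2) * \<Omega> v - 1/8 * (dist v ?u)\<^sup>2)"
    using rho_pos by (simp add: dist_commute)
  moreover have "(\<Sum>a\<in>UNIV. l a * pmf w a)
      = (1/2) * (\<Sum>a\<in>UNIV. l a * pmf ?u a) + (1/2) * (\<Sum>a\<in>UNIV. l a * pmf v a)"
    using w by (simp add: sum_distrib_left algebra_simps sum.distrib flip: sum_divide_distrib)
  ultimately have "reg_val l w \<le> (1/2) * reg_val l ?u + (1/2) * reg_val l v - \<rho>/8 * (dist v ?u)\<^sup>2"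
    unfolding reg_val_def by (simp add: algebra_simps)
  with reg_val_response_le[of l w] show ?thesis by (simp add: algebra_simps)
qed

text \<open>The term \<open>\<rho> * \<Omega> u\<close> cancels and the linear form left has weights
  at most 1, so the bound is uniform in \<open>u\<close>.\<close>

lemma reg_val_diff_le: "reg_val l u - reg_val l' u \<le> (\<Sum>a\<in>UNIV. \<bar>l a - l' a\<bar>)"
proof -
  have "reg_val l u - reg_val l' u = (\<Sum>a\<in>UNIV. (l a - l' a) * pmf u a)"
    by (simp add: reg_val_def left_diff_distrib sum_subtractf)
  also have "\<dots> \<le> (\<Sum>a\<in>UNIV. \<bar>l a - l' a\<bar> * 1)"
    by (intro sum_mono mult_mono) (auto simp: pmf_le_1)
  finally show ?thesis by simp
qed

text \<open>Each minimizer competes in the other problem, so the optimal value is 1-Lipschitz in the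
  coefficients for the l1 distance.\<close>

lemma tendsto_opt_val:
  assumes "\<And>a. ((\<lambda>n. ls n a) \<longlongrightarrow> l a) F"
  shows "((\<lambda>n. reg_val (ls n) (response (ls n))) \<longlongrightarrow> reg_val l (response l)) F"
proof (rule LIM_zero_cancel, rule Lim_null_comparison[OF always_eventually tendsto_sum_abs_diff[OF assms]], rule allI)
  fix n
  have "(\<Sum>a\<in>UNIV. \<bar>l a - ls n a\<bar>) = (\<Sum>a\<in>UNIV. \<bar>ls n a - l a\<bar>)"
    by (simp add: abs_minus_commute)
  then show "norm (reg_val (ls n) (response (ls n)) - reg_val l (response l)) \<le> (\<Sum>a\<in>UNIV. \<bar>ls n a - l a\<bar>)"
    using reg_val_diff_le[of "ls n" "response l" l] reg_val_diff_le[of l "response (ls n)" "ls n"]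
      reg_val_response_le[of "ls n" "response l"] reg_val_response_le[of l "response (ls n)"]
    by simp
qed

text \<open>Add the quadratic growth of each problem at the minimizer of the other. What remains are
  two differences of \<open>reg_val l\<close> and \<open>reg_val l'\<close> at a common control,
  each bounded by \<open>reg_val_diff_le\<close>.\<close>

lemma response_dist_sq_le:
  "(dist (response l') (response l))\<^sup>2 \<le> 4 / \<rho> * (\<Sum>a\<in>UNIV. \<bar>l' a - l a\<bar>)"
proof -
  have sym: "(\<Sum>a\<in>UNIV. \<bar>l a - l' a\<bar>) = (\<Sum>a\<in>UNIV. \<bar>l' a - l a\<bar>)"
    by (simp add: abs_minus_commute)
  have "\<rho> / 2 * (dist (response l') (response l))\<^sup>2 \<le> 2 * (\<Sum>a\<in>UNIV. \<bar>l' a - l a\<bar>)"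
    using reg_val_quadratic_growth[of l "response l'"] reg_val_quadratic_growth[of l' "response l"]
      reg_val_diff_le[of l "response l'" l'] reg_val_diff_le[of l' "response l" l] sym
    by (simp add: dist_commute)
  then show ?thesis using rho_pos by (simp add: field_simps)
qed

lemma tendsto_response:
  assumes "\<And>a. ((\<lambda>n. ls n a) \<longlongrightarrow> l a) F"
  shows "((\<lambda>n. response (ls n)) \<longlongrightarrow> response l) F"
proof -
  have bound: "((\<lambda>n. 4 / \<rho> * (\<Sum>a\<in>UNIV. \<bar>ls n a - l a\<bar>)) \<longlongrightarrow> 0) F"
    using tendsto_mult_left[OF tendsto_sum_abs_diff[OF assms], of "4 / \<rho>"] by simp
  have "((\<lambda>n. (dist (response (ls n)) (response l))\<^sup>2) \<longlongrightarrow> 0) F"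
    by (rule Lim_null_comparison[OF always_eventually bound]) (simp add: response_dist_sq_le del: times_divide_eq_left)
  then have "((\<lambda>n. sqrt ((dist (response (ls n)) (response l))\<^sup>2)) \<longlongrightarrow> sqrt 0) F"
    by (rule tendsto_real_sqrt)
  then show ?thesis
    by (subst tendsto_dist_iff) simp
qed

section \<open>The backward recursion on affine parts\<close>

definition bellman :: "('x \<Rightarrow> 'a \<Rightarrow> real) \<Rightarrow> 'x pmf \<Rightarrow> 'x \<Rightarrow> 'a \<Rightarrow> real" where
  "bellman q \<mu> x a = c x a \<mu> + (\<Sum>y\<in>UNIV. reg_val (q y) (response (q y)) * (pmf (p x a \<mu>) y - lam y))"

lemma reg_Q_eq_reg_val: "reg_Q \<rho> \<Omega> q x = reg_val (q x)"
  by (simp add: fun_eq_iff reg_Q_def reg_val_def)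

text \<open>The infimum is attained at \<open>response (q y)\<close> and
  \<open>avg_subkernel\<close> is linear in \<open>u\<close>, so swapping the sums over states and
  actions shows an affine part again. Every Q-function of an equilibrium is thus determined by its
  coefficients.\<close>

lemma H1_avg_reg_Q: "H1_avg c p lam \<rho> \<Omega> (reg_Q \<rho> \<Omega> q) \<mu> = reg_Q \<rho> \<Omega> (bellman q \<mu>)"
proof (intro ext)
  fix x u
  have "(\<Sum>y\<in>UNIV. reg_val (q y) (response (q y)) * (\<Sum>a\<in>UNIV. (pmf (p x a \<mu>) y - lam y) * pmf u a))
    = (\<Sum>a\<in>UNIV. (\<Sum>y\<in>UNIV. reg_val (q y) (response (q y)) * (pmf (p x a \<mu>) y - lam y)) * pmf u a)"
    unfolding sum_distrib_left sum_distrib_right by (subst sum.swap) (simp add: mult.assoc)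
  then show "H1_avg c p lam \<rho> \<Omega> (reg_Q \<rho> \<Omega> q) \<mu> x u = reg_Q \<rho> \<Omega> (bellman q \<mu>) x u"
    unfolding H1_avg_def reg_Q_eq_reg_val INF_reg_val avg_cost_def avg_subkernel_def
    by (simp add: reg_val_def[of "bellman q \<mu> x"] bellman_def distrib_right sum.distrib)
qed

lemma tendsto_cost:
  assumes "(\<mu>n \<longlongrightarrow> \<mu>) F"
  shows "((\<lambda>n. c x a (\<mu>n n)) \<longlongrightarrow> c x a \<mu>) F"
proof (rule LIM_zero_cancel, rule Lim_null_comparison)
  have "norm (c x a (\<mu>n n) - c x a \<mu>) \<le> L\<^sub>1 * dist (\<mu>n n) \<mu>" for n
    using lipschitz[unfolded lipschitz_model_def, THEN conjunct1, rule_format, of x a "\<mu>n n" x a \<mu>]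
    by simp
  then show "\<forall>\<^sub>F n in F. norm (c x a (\<mu>n n) - c x a \<mu>) \<le> L\<^sub>1 * dist (\<mu>n n) \<mu>"
    by simp
  show "((\<lambda>n. L\<^sub>1 * dist (\<mu>n n) \<mu>) \<longlongrightarrow> 0) F"
    using tendsto_mult_left[OF tendsto_dist_iff[THEN iffD1, OF assms], of L\<^sub>1] by simp
qed

lemma tendsto_kernel:
  assumes "(\<mu>n \<longlongrightarrow> \<mu>) F"
  shows "((\<lambda>n. p x a (\<mu>n n)) \<longlongrightarrow> p x a \<mu>) F"
proof (rule tendsto_dist_iff[THEN iffD2], rule Lim_null_comparison)
  have "norm (dist (p x a (\<mu>n n)) (p x a \<mu>)) \<le> K\<^sub>1 * dist (\<mu>n n) \<mu>" for n
    using lipschitz[unfolded lipschitz_model_def, THEN conjunct2, rule_format, of x a "\<mu>n n" x a \<mu>]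
    by simp
  then show "\<forall>\<^sub>F n in F. norm (dist (p x a (\<mu>n n)) (p x a \<mu>)) \<le> K\<^sub>1 * dist (\<mu>n n) \<mu>"
    by simp
  show "((\<lambda>n. K\<^sub>1 * dist (\<mu>n n) \<mu>) \<longlongrightarrow> 0) F"
    using tendsto_mult_left[OF tendsto_dist_iff[THEN iffD1, OF assms], of K\<^sub>1] by simp
qed

lemma tendsto_bellman:
  assumes q: "\<And>x a. ((\<lambda>n. qn n x a) \<longlongrightarrow> q x a) F" and \<mu>: "(\<mu>n \<longlongrightarrow> \<mu>) F"
  shows "((\<lambda>n. bellman (qn n) (\<mu>n n) x a) \<longlongrightarrow> bellman q \<mu> x a) F"
proof -
  have "((\<lambda>n. pmf (p x a (\<mu>n n)) y) \<longlongrightarrow> pmf (p x a \<mu>) y) F" for y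
    using tendsto_kernel[OF \<mu>] unfolding tendsto_pmf_iff by blast
  then show ?thesis
    unfolding bellman_def by (intro tendsto_intros tendsto_cost[OF \<mu>] tendsto_opt_val q)
qed

primrec q_iter :: "('x \<Rightarrow> 'a \<Rightarrow> real) \<Rightarrow> (nat \<Rightarrow> 'x pmf) \<Rightarrow> nat \<Rightarrow> 'x \<Rightarrow> 'a \<Rightarrow> real" where
  "q_iter q \<mu> 0 = q"
| "q_iter q \<mu> (Suc t) = bellman (q_iter q \<mu> t) (\<mu> (Suc t))"

lemma tendsto_q_iter:
  assumes "\<And>x a. ((\<lambda>n. qn n x a) \<longlongrightarrow> q x a) F" and "\<And>t. ((\<lambda>n. \<mu>n n t) \<longlongrightarrow> \<mu> t) F"
  shows "((\<lambda>n. q_iter (qn n) (\<mu>n n) t x a) \<longlongrightarrow> q_iter q \<mu> t x a) F"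
  using assms by (induction t arbitrary: x a) (simp_all add: tendsto_bellman)

abbreviation control :: "('x \<Rightarrow> 'a \<Rightarrow> real) \<Rightarrow> (nat \<Rightarrow> 'x pmf) \<Rightarrow> nat \<Rightarrow> 'x \<Rightarrow> 'a pmf" where
  "control q \<mu> t x \<equiv> response (q_iter q \<mu> t x)"

text \<open>Terminal coefficients and measures vary jointly along any filter: existence takes the
  former constant along \<open>at \<mu>\<close>, the horizon limit lets both vary along a filter
  finer than \<open>sequentially\<close>.\<close>

lemma tendsto_control:
  assumes "\<And>x a. ((\<lambda>n. qn n x a) \<longlongrightarrow> q x a) F" and "\<And>t. ((\<lambda>n. \<mu>n n t) \<longlongrightarrow> \<mu> t) F"
  shows "((\<lambda>n. control (qn n) (\<mu>n n) t x) \<longlongrightarrow> control q \<mu> t x) F"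
  by (intro tendsto_response tendsto_q_iter assms)

section \<open>Forward evolution of the state and equilibria\<close>

definition flow :: "('x \<Rightarrow> 'a pmf) \<Rightarrow> 'x pmf \<Rightarrow> 'x pmf" where
  "flow u \<mu> = bind_pmf \<mu> (\<lambda>x. bind_pmf (u x) (\<lambda>a. p x a \<mu>))"

lemma pmf_flow: "pmf (flow u \<mu>) y = (\<Sum>x\<in>UNIV. avg_kernel p x (u x) \<mu> y * pmf \<mu> x)"
  by (simp add: flow_def pmf_bind_finite avg_kernel_def)

text \<open>\<open>H2\<close> yields only a real function; \<open>flow\<close>, built with
  \<open>bind_pmf\<close>, presents it as a \<open>pmf\<close> for Dirac policies.\<close>

lemma H2_return: "H2 p (\<lambda>x. return borel (u x)) \<mu> = pmf (flow u \<mu>)"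
proof
  fix y
  have "(\<integral>v. avg_kernel p x v \<mu> y \<partial>return borel (u x)) = avg_kernel p x (u x) \<mu> y" for x
    unfolding avg_kernel_def
    by (intro integral_return borel_measurable_continuous_onI continuous_intros continuous_on_pmf) auto
  then show "H2 p (\<lambda>x. return borel (u x)) \<mu> y = pmf (flow u \<mu>) y"
    by (simp add: H2_def pmf_flow)
qed

lemma tendsto_flow:
  assumes u: "\<And>x. ((\<lambda>n. un n x) \<longlongrightarrow> u x) F" and \<mu>: "(\<mu>n \<longlongrightarrow> \<mu>) F"
  shows "((\<lambda>n. flow (un n) (\<mu>n n)) \<longlongrightarrow> flow u \<mu>) F"
proof -
  have "((\<lambda>n. pmf (p x a (\<mu>n n)) y) \<longlongrightarrow> pmf (p x a \<mu>) y) F"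
    "((\<lambda>n. pmf (un n x) a) \<longlongrightarrow> pmf (u x) a) F" "((\<lambda>n. pmf (\<mu>n n) x) \<longlongrightarrow> pmf \<mu> x) F" for x a y
    using tendsto_kernel[OF \<mu>] u \<mu> unfolding tendsto_pmf_iff by blast+
  then show ?thesis
    unfolding tendsto_pmf_iff pmf_flow avg_kernel_def by (intro allI tendsto_intros)
qed

lemma avg_TRMFE_control:
  assumes "\<And>t. \<mu> t = flow (control q \<mu> (Suc t)) (\<mu> (Suc t))"
  shows "avg_TRMFE c p lam \<rho> \<Omega> (reg_Q \<rho> \<Omega> q) (\<lambda>t x. return borel (control q \<mu> t x)) \<mu>"
  unfolding avg_TRMFE_def
proof (intro conjI allI exI[of _ "\<lambda>t. reg_Q \<rho> \<Omega> (q_iter q \<mu> t)"])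
  show "policy (\<lambda>x. return borel (control q \<mu> t x))" for t
    by (simp add: policy_def return_mem_prob_algebra)
  show "pmf (\<mu> t) = H2 p (\<lambda>x. return borel (control q \<mu> (Suc t) x)) (\<mu> (Suc t))" for t
    unfolding H2_return using assms[of t] by (rule arg_cong)
  show "AE u in return borel (control q \<mu> t x). u \<in> minimizers (reg_Q \<rho> \<Omega> (q_iter q \<mu> t) x)" for t x
    by (simp add: reg_Q_eq_reg_val minimizers_reg_val AE_return)
qed (simp_all add: H1_avg_reg_Q)

text \<open>No earliest time exists from which to run the forward equation, so it is solved at all
  times at once: entry \<open>t\<close> of \<open>G \<mu>\<close> is a continuous function of
  \<open>\<mu> 1\<close>, ..., \<open>\<mu> (Suc t)\<close>.\<close>

lemma avg_TRMFE_exists: "\<exists>\<pi> \<mu>. avg_TRMFE c p lam \<rho> \<Omega> (reg_Q \<rho> \<Omega> q) \<pi> \<mu>"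
proof -
  define G where "G \<mu> t = flow (control q \<mu> (Suc t)) (\<mu> (Suc t))" for \<mu> t
  have "(G \<longlongrightarrow> G \<mu>) (at \<mu>)" for \<mu>
  proof -
    have "((\<lambda>\<nu>. \<nu> t) \<longlongrightarrow> \<mu> t) (at \<mu>)" for t
      using tendsto_ident_at[of \<mu> UNIV] unfolding tendsto_fun_iff by blast
    then show ?thesis
      unfolding tendsto_fun_iff[of G] G_def by (intro allI tendsto_flow tendsto_control) auto
  qed
  then obtain \<mu> where "G \<mu> = \<mu>"
    using pmf_sequence_fixpoint[of G] unfolding continuous_on_def by blast
  then have "\<mu> t = flow (control q \<mu> (Suc t)) (\<mu> (Suc t))" for t
    by (metis G_def)
  then show ?thesis using avg_TRMFE_control by blast
qed

text \<open>Induction on \<open>t\<close> identifies the Q-functions with those of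
  \<open>q_iter\<close>; uniqueness of minimizers then makes the policies Dirac, and
  \<open>H2_return\<close> gives the evolution.\<close>

lemma avg_finite_MFE_control:
  assumes "avg_finite_MFE c p lam \<rho> \<Omega> T \<mu>init (reg_Q \<rho> \<Omega> q) \<pi> \<mu>"
  shows "t \<le> T \<Longrightarrow> \<pi> t = (\<lambda>x. return borel (control q \<mu> t x))"
    and "t < T \<Longrightarrow> \<mu> t = flow (control q \<mu> (Suc t)) (\<mu> (Suc t))"
proof -
  obtain Q where pol: "\<forall>t\<le>T. policy (\<pi> t)" and Q0: "Q 0 = reg_Q \<rho> \<Omega> q"
    and QS: "\<forall>t<T. Q (Suc t) = H1_avg c p lam \<rho> \<Omega> (Q t) (\<mu> (Suc t))"
    and \<mu>: "\<forall>t<T. pmf (\<mu> t) = H2 p (\<pi> (Suc t)) (\<mu> (Suc t))"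
    and opt: "\<forall>t\<le>T. \<forall>x. AE u in \<pi> t x. u \<in> minimizers (Q t x)"
    using assms unfolding avg_finite_MFE_def by blast
  have Q: "t \<le> T \<Longrightarrow> Q t = reg_Q \<rho> \<Omega> (q_iter q \<mu> t)" for t
    by (induction t) (simp_all add: Q0 QS H1_avg_reg_Q)
  show \<pi>: "\<pi> t = (\<lambda>x. return borel (control q \<mu> t x))" if "t \<le> T" for t
    using pol opt that by (auto simp: fun_eq_iff policy_def Q reg_Q_eq_reg_val minimizers_reg_val
      intro!: prob_AE_eq_return)
  show "\<mu> t = flow (control q \<mu> (Suc t)) (\<mu> (Suc t))" if "t < T"
    using \<mu> that by (intro pmf_eqI) (simp add: \<pi> H2_return)
qed

end

section \<open>Weak limits of state-control distributions\<close>

lemma measurable_graph: "(\<lambda>x. (x, u x)) \<in> count_space UNIV \<rightarrow>\<^sub>M state_control_space"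
  by (simp add: space_pair_measure)

lemma policy_prod_return:
  "policy_prod (\<lambda>x. return borel (u x)) \<mu> = distr (measure_pmf \<mu>) state_control_space (\<lambda>x. (x, u x))"
proof -
  have "distr (return borel (u x)) state_control_space (Pair x) = return state_control_space (x, u x)" for x
    by (rule distr_return) auto
  then show ?thesis
    unfolding policy_prod_def
    by (simp add: bind_return_distr' measurable_graph[unfolded measurable_count_space_eq1] space_pair_measure)
qed

lemma measurable_state_control:
  assumes "\<And>x. continuous_on UNIV (\<lambda>u. f (x, u))"
  shows "f \<in> borel_measurable (state_control_space :: ('x::finite \<times> 'a::finite pmf) measure)"
  by (rule measurable_pair_measure_countable1)
    (auto intro: borel_measurable_continuous_onI assms countable_finite)

text \<open>Over a discrete first factor, a preimage is a union of open slices. This admits test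
  functions continuous in the control alone.\<close>

lemma continuous_map_state_control:
  fixes f :: "'x::finite \<times> 'a::finite pmf \<Rightarrow> real"
  assumes "\<And>x. continuous_on UNIV (\<lambda>u. f (x, u))"
  shows "continuous_map (prod_topology (discrete_topology UNIV) euclidean) euclideanreal f"
  unfolding continuous_map_def
proof (intro conjI allI impI)
  fix U :: "real set" assume "openin euclideanreal U"
  then have U: "open U" by simp
  have eq: "{z. f z \<in> U} = (\<Union>x. {x} \<times> {u. f (x, u) \<in> U})" by auto
  have "open {u. f (x, u) \<in> U}" for x
    using open_vimage[OF U assms[of x]] by (simp add: vimage_def)
  then have "openin (prod_topology (discrete_topology UNIV) euclidean) ({x} \<times> {u. f (x, u) \<in> U})" for x
    by (simp add: openin_prod_Times_iff)
  then show "openin (prod_topology (discrete_topology UNIV) euclidean)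
      {z \<in> topspace (prod_topology (discrete_topology UNIV) euclidean). f z \<in> U}"
    by (auto simp: eq intro!: openin_Union)
qed simp

lemma integral_policy_prod_return:
  fixes f :: "'x::finite \<times> 'a::finite pmf \<Rightarrow> real"
  assumes "\<And>x. continuous_on UNIV (\<lambda>u. f (x, u))"
  shows "(\<integral>z. f z \<partial>policy_prod (\<lambda>x. return borel (u x)) \<mu>) = (\<Sum>x\<in>UNIV. f (x, u x) * pmf \<mu> x)"
  unfolding policy_prod_return
  by (subst integral_distr) (auto simp: measurable_state_control[OF assms] space_pair_measure intro!: integral_measure_pmf_real)

text \<open>On the graph of \<open>u\<close> the map \<open>(fst z, u (fst z))\<close> is almost
  surely the identity, so \<open>N\<close> is the image of its first marginal under the graph
  map.\<close>

lemma eq_policy_prod_return: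
  fixes N :: "('x::finite \<times> 'a::finite pmf) measure"
  assumes N: "N \<in> space (prob_algebra state_control_space)"
    and graph: "AE z in N. snd z = u (fst z)"
    and marginal: "\<And>x. (\<integral>z. indicator {x} (fst z) \<partial>N) = pmf \<mu> x"
  shows "N = policy_prod (\<lambda>x. return borel (u x)) \<mu>"
proof -
  interpret prob_space N using N by (simp add: space_prob_algebra)
  have sets[measurable_cong]: "sets N = sets state_control_space" using N by (simp add: space_prob_algebra)
  have sp: "space N = UNIV" using sets_eq_imp_space_eq[OF sets] by (simp add: space_pair_measure)
  have fst: "fst \<in> N \<rightarrow>\<^sub>M count_space UNIV" by measurable
  have g: "(\<lambda>z. (fst z, u (fst z))) \<in> N \<rightarrow>\<^sub>M state_control_space"
    using measurable_compose[OF fst measurable_graph[of u]] .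
  have "distr N (count_space UNIV) fst = measure_pmf \<mu>"
  proof (rule measure_eqI_countable[of _ UNIV])
    fix x
    have "emeasure (distr N (count_space UNIV) fst) {x} = emeasure N (fst -` {x})"
      using fst by (simp add: emeasure_distr sp)
    also have "\<dots> = ennreal (measure N (fst -` {x}))"
      by (simp add: emeasure_eq_measure)
    also have "measure N (fst -` {x}) = (\<integral>z. indicator (fst -` {x}) z \<partial>N)"
      by (simp add: sp)
    also have "\<dots> = pmf \<mu> x"
      unfolding marginal[symmetric] by (intro Bochner_Integration.integral_cong) (auto simp: indicator_def)
    finally show "emeasure (distr N (count_space UNIV) fst) {x} = emeasure (measure_pmf \<mu>) {x}"
      by (simp add: emeasure_pmf_single)
  qed auto
  then have "policy_prod (\<lambda>x. return borel (u x)) \<mu>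
      = distr (distr N (count_space UNIV) fst) state_control_space (\<lambda>x. (x, u x))"
    by (simp add: policy_prod_return)
  also have "\<dots> = distr N state_control_space (\<lambda>z. (fst z, u (fst z)))"
    using distr_distr[OF measurable_graph[of u] fst] by (simp add: o_def)
  also have "\<dots> = distr N N (\<lambda>z. z)"
    by (rule distr_cong_AE) (use graph g sets in \<open>auto simp: prod_eq_iff\<close>)
  finally show ?thesis by simp
qed

text \<open>An accumulation point need not be the limit of a subsequence, since \<open>weak_topology\<close> is not known to be
  first countable; it is the limit along a filter finer than \<open>sequentially\<close>.\<close>

lemma accumulation_point_weakE:
  fixes z :: "'i \<Rightarrow> ('x::finite \<times> 'a::finite pmf) measure"
  assumes "accumulation_point (product_topology (\<lambda>_. weak_topology) UNIV) s z"
  obtains F where "F \<noteq> bot" "F \<le> sequentially"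
    "\<And>t. z t \<in> space (prob_algebra state_control_space)"
    "\<And>t (f :: _ \<Rightarrow> real). (\<And>x. continuous_on UNIV (\<lambda>u. f (x, u))) \<Longrightarrow> bounded (range f) \<Longrightarrow>
      ((\<lambda>n. \<integral>w. f w \<partial>s n t) \<longlongrightarrow> (\<integral>w. f w \<partial>z t)) F"
proof -
  let ?X = "product_topology (\<lambda>_::'i. weak_topology :: ('x \<times> 'a pmf) measure topology) UNIV"
  let ?F = "inf sequentially (filtercomap s (nhdsin ?X z))"
  have z: "z \<in> topspace ?X" and freq: "\<And>U. openin ?X U \<Longrightarrow> z \<in> U \<Longrightarrow> \<exists>\<^sub>F n in sequentially. s n \<in> U"
    using assms by (auto simp: accumulation_point_def)
  have near: "\<forall>\<^sub>F n in ?F. s n \<in> U" if "openin ?X U" "z \<in> U" for U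
  proof -
    have "\<forall>\<^sub>F n in filtercomap s (nhdsin ?X z). s n \<in> U"
      using that by (auto simp: eventually_filtercomap eventually_nhdsin intro!: exI[of _ "\<lambda>y. y \<in> U"])
    then show ?thesis by (rule filter_leD[OF inf_le2])
  qed
  \<comment> \<open>Otherwise some neighbourhood of \<open>z\<close> would be avoided by
    \<open>s n\<close> for all large \<open>n\<close>.\<close>
  have "?F \<noteq> bot"
  proof
    assume "?F = bot"
    then have "eventually (\<lambda>_. False) ?F" by simp
    then obtain Q R where Q: "eventually Q sequentially"
      and R: "eventually R (filtercomap s (nhdsin ?X z))" and QR: "\<forall>n. \<not> (Q n \<and> R n)"
      by (auto simp: eventually_inf)
    from R z obtain U where U: "openin ?X U" "z \<in> U" "\<forall>n. s n \<in> U \<longrightarrow> R n"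
      by (auto simp: eventually_filtercomap eventually_nhdsin)
    have "\<exists>\<^sub>F n in sequentially. s n \<in> U \<and> Q n"
      using frequently_eventually_frequently[OF freq[OF U(1,2)] Q] .
    then show False using U(3) QR by (auto dest: frequently_ex)
  qed
  moreover have zt: "z t \<in> space (prob_algebra state_control_space)" for t
  proof -
    have "z t \<in> topspace weak_topology" using z by (auto simp: PiE_iff)
    then show ?thesis unfolding weak_topology_def topology_generated_by_topspace by blast
  qed
  moreover have "((\<lambda>n. \<integral>w. f w \<partial>s n t) \<longlongrightarrow> (\<integral>w. f w \<partial>z t)) ?F"
    if f: "\<And>x. continuous_on UNIV (\<lambda>u. f (x, u))" "bounded (range f)" for t and f :: "'x \<times> 'a pmf \<Rightarrow> real"
  proof (rule topological_tendstoI)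
    fix V :: "real set" assume V: "open V" "(\<integral>w. f w \<partial>z t) \<in> V"
    let ?W = "{N \<in> space (prob_algebra state_control_space). (\<integral>w. f w \<partial>N) \<in> V}"
    have "openin weak_topology ?W"
      unfolding weak_topology_def using continuous_map_state_control[OF f(1)] f(2) V(1)
      by (intro topology_generated_by_Basis) blast
    then have "openin ?X {y \<in> topspace ?X. y t \<in> ?W}"
      by (intro openin_continuous_map_preimage[OF continuous_map_product_projection]) auto
    then have "\<forall>\<^sub>F n in ?F. s n \<in> {y \<in> topspace ?X. y t \<in> ?W}"
      by (rule near) (use z zt V in auto)
    then show "\<forall>\<^sub>F n in ?F. (\<integral>w. f w \<partial>s n t) \<in> V"
      by eventually_elim blast
  qed
  ultimately show thesis using that[of ?F] by simp
qed

text \<open>A crude bound, making the distance to a given control a bounded test function.\<close>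

lemma dist_pmf_le: "dist u v \<le> 2 * real (card (UNIV :: 'a set))" for u v :: "'a::finite pmf"
proof -
  have "dist u v \<le> (\<Sum>a\<in>(UNIV::'a set). 2)"
    unfolding dist_pmf_def
    by (intro sum_mono) (smt (verit) pmf_nonneg pmf_le_1)
  then show ?thesis by simp
qed

text \<open>Testing the weak limit against the indicators of states identifies its marginal; testing it against
  the distance to the limiting controls shows that it is carried by their graph.\<close>

lemma weak_limit_eq_policy_prod:
  fixes N :: "('x::finite \<times> 'a::finite pmf) measure"
  assumes F: "F \<noteq> bot"
    and N: "N \<in> space (prob_algebra state_control_space)"
    and conv: "\<And>f :: _ \<Rightarrow> real. (\<And>x. continuous_on UNIV (\<lambda>u. f (x, u))) \<Longrightarrow> bounded (range f) \<Longrightarrow>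
      ((\<lambda>n. \<integral>w. f w \<partial>Ns n) \<longlongrightarrow> (\<integral>w. f w \<partial>N)) F"
    and Ns: "\<forall>\<^sub>F n in F. Ns n = policy_prod (\<lambda>x. return borel (us n x)) (\<mu>s n)"
    and us: "\<And>x. ((\<lambda>n. us n x) \<longlongrightarrow> u x) F" and \<mu>s: "(\<mu>s \<longlongrightarrow> \<mu>) F"
  shows "N = policy_prod (\<lambda>x. return borel (u x)) \<mu>"
proof (rule eq_policy_prod_return[OF N])
  interpret prob_space N using N by (simp add: space_prob_algebra)
  have sets: "sets N = sets state_control_space" using N by (simp add: space_prob_algebra)
  \<comment> \<open>The integrals along \<open>Ns\<close> have two limits: this integral by weak
    convergence, and the finite sum by continuity of \<open>f\<close> in the control.\<close>
  have lim: "(\<integral>w. f w \<partial>N) = (\<Sum>x\<in>UNIV. f (x, u x) * pmf \<mu> x)"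
    if f: "\<And>x. continuous_on UNIV (\<lambda>u. f (x, u))" "bounded (range f)" for f
  proof (rule tendsto_unique[OF F conv[OF f]])
    have "((\<lambda>n. f (x, us n x)) \<longlongrightarrow> f (x, u x)) F" for x
      by (rule continuous_on_tendsto_compose[OF f(1) us]) auto
    moreover have "((\<lambda>n. pmf (\<mu>s n) x) \<longlongrightarrow> pmf \<mu> x) F" for x
      using \<mu>s unfolding tendsto_pmf_iff by blast
    ultimately have "((\<lambda>n. \<Sum>x\<in>UNIV. f (x, us n x) * pmf (\<mu>s n) x) \<longlongrightarrow> (\<Sum>x\<in>UNIV. f (x, u x) * pmf \<mu> x)) F"
      by (intro tendsto_intros)
    then show "((\<lambda>n. \<integral>w. f w \<partial>Ns n) \<longlongrightarrow> (\<Sum>x\<in>UNIV. f (x, u x) * pmf \<mu> x)) F"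
      by (rule Lim_transform_eventually)
        (use Ns in \<open>auto elim!: eventually_mono simp: integral_policy_prod_return[OF f(1)]\<close>)
  qed
  show "(\<integral>z. indicator {x} (fst z) \<partial>N) = pmf \<mu> x" for x
    by (subst lim) (auto simp: indicator_def if_distrib[of "\<lambda>r. r * _"] sum.delta cong: if_cong
        intro!: boundedI[of _ 1])
  define d where "d = (\<lambda>z :: 'x \<times> 'a pmf. dist (snd z) (u (fst z)))"
  have d_cont: "continuous_on UNIV (\<lambda>u. d (x, u))" for x
    unfolding d_def by (auto intro!: continuous_intros)
  have d_le: "norm (d z) \<le> 2 * real (card (UNIV :: 'a set))" for z
    by (simp add: d_def dist_pmf_le)
  have "d \<in> borel_measurable N"
    using measurable_state_control[OF d_cont] sets by (simp cong: measurable_cong_sets)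
  then have int: "integrable N d"
    by (intro integrable_const_bound[of _ "2 * real (card (UNIV :: 'a set))"]) (use d_le in \<open>simp_all add: always_eventually\<close>)
  have "(\<integral>z. d z \<partial>N) = 0"
    by (subst lim[OF d_cont]) (auto simp: d_def intro!: boundedI[of _ "2 * real (card (UNIV :: 'a set))"] dist_pmf_le)
  then have "AE z in N. d z = 0"
    using int by (subst (asm) integral_nonneg_eq_0_iff_AE) (auto simp: d_def)
  then show "AE z in N. snd z = u (fst z)"
    by (simp add: d_def)
qed

section \<open>Convergence in the weighted norm and the limit of finite horizons\<close>

lemma Q_norm_reg_Q_pointwise:
  fixes q q' :: "'x::finite \<Rightarrow> 'a::finite \<Rightarrow> real"
  assumes \<omega>: "\<And>x a. 1 \<le> \<omega> x a"
  shows "\<bar>q x a - q' x a\<bar> \<le> \<omega> x a * Q_norm \<omega> (\<lambda>x u. reg_Q \<rho> \<Omega> q x u - reg_Q \<rho> \<Omega> q' x u)"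
proof -
  define D where "D x u = reg_Q \<rho> \<Omega> q x u - reg_Q \<rho> \<Omega> q' x u" for x u
  define w where "w x u = (\<Sum>a\<in>UNIV. \<omega> x a * pmf u a)" for x u
  have D: "D x u = (\<Sum>a\<in>UNIV. (q x a - q' x a) * pmf u a)" for x u
    by (simp add: D_def reg_Q_def left_diff_distrib sum_subtractf)
  have w: "1 \<le> w x u" for x u
  proof -
    have "(\<Sum>a\<in>UNIV. 1 * pmf u a) \<le> w x u"
      unfolding w_def by (intro sum_mono mult_right_mono \<omega>) auto
    then show ?thesis by (simp add: sum_pmf_eq_1)
  qed
  \<comment> \<open>A real \<open>SUP\<close> dominates its members only if they are bounded above,
    hence this bound free of \<open>x\<close> and \<open>u\<close>.\<close>
  have "\<bar>D x u\<bar> / w x u \<le> (\<Sum>x\<in>UNIV. \<Sum>a\<in>UNIV. \<bar>q x a - q' x a\<bar>)" for x u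
  proof -
    have "\<bar>D x u\<bar> / w x u \<le> \<bar>D x u\<bar>" 
      using w[of x u] by (simp add: divide_le_eq mult_le_cancel_left1)
    also have "\<dots> \<le> (\<Sum>a\<in>UNIV. \<bar>q x a - q' x a\<bar> * 1)"
      unfolding D by (rule order_trans[OF sum_abs])
        (auto simp: abs_mult pmf_le_1 intro!: sum_mono mult_left_le)
    also have "\<dots> \<le> (\<Sum>x\<in>UNIV. \<Sum>a\<in>UNIV. \<bar>q x a - q' x a\<bar>)"
      by (simp, rule member_le_sum) (auto intro: sum_nonneg)
    finally show ?thesis .
  qed
  then have "bdd_above (range (\<lambda>(x, u). \<bar>D x u\<bar> / w x u))"
    by (intro bdd_aboveI2) auto
  \<comment> \<open>A Dirac control isolates one coefficient, as \<open>\<Omega>\<close> has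
    cancelled in \<open>D\<close>.\<close>
  then have "\<bar>D x (return_pmf a)\<bar> / w x (return_pmf a) \<le> Q_norm \<omega> D"
    unfolding Q_norm_def w_def[symmetric] by (rule cSUP_upper2[of _ _ "(x, return_pmf a)"]) auto
  moreover have "D x (return_pmf a) = q x a - q' x a" "w x (return_pmf a) = \<omega> x a"
    by (simp_all add: D w_def indicator_def if_distrib[of "\<lambda>r. _ * r"] cong: if_cong)
  ultimately show ?thesis
    using \<omega>[of x a] unfolding D_def by (simp add: field_simps)
qed

theorem theorem5:
  fixes c :: "'x::finite \<Rightarrow> 'a::finite \<Rightarrow> 'x pmf \<Rightarrow> real"
    and p :: "'x \<Rightarrow> 'a \<Rightarrow> 'x pmf \<Rightarrow> 'x pmf"
    and \<rho> :: real and \<Omega> :: "'a pmf \<Rightarrow> real"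
    and lam :: "'x \<Rightarrow> real" and \<omega> :: "'x \<Rightarrow> 'a \<Rightarrow> real"
    and \<alpha> b L\<^sub>1 K\<^sub>1 :: real
  assumes "regularized_model c \<rho> \<Omega>"
    and "minorization_drift p lam \<omega> \<alpha> b"
    and "lipschitz_model c p L\<^sub>1 K\<^sub>1"
    and "\<alpha> * K\<^sub>1 < 2"
  shows "(\<forall>Qterm \<in> C_alpha c \<rho> \<Omega> \<omega> \<alpha> L\<^sub>1 K\<^sub>1. \<exists>\<pi> \<mu>. avg_TRMFE c p lam \<rho> \<Omega> Qterm \<pi> \<mu>)
    \<and> ((\<forall>Q \<in> C_alpha c \<rho> \<Omega> \<omega> \<alpha> L\<^sub>1 K\<^sub>1. \<exists>!(\<pi>, \<mu>). avg_TRMFE c p lam \<rho> \<Omega> Q \<pi> \<mu>) \<longrightarrow>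
        (\<forall>Qterm QT \<mu>init \<pi>T \<mu>T \<nu> z.
            Qterm \<in> C_alpha c \<rho> \<Omega> \<omega> \<alpha> L\<^sub>1 K\<^sub>1
          \<and> (\<forall>T. QT T \<in> C_alpha c \<rho> \<Omega> \<omega> \<alpha> L\<^sub>1 K\<^sub>1)
          \<and> (\<lambda>T. Q_norm \<omega> (\<lambda>x u. QT T x u - Qterm x u)) \<longlonglongrightarrow> 0
          \<and> (\<forall>T. avg_finite_MFE c p lam \<rho> \<Omega> T \<mu>init (QT T) (\<pi>T T) (\<mu>T T))
          \<and> \<nu> \<in> space (prob_algebra state_control_space)
          \<and> accumulation_point (product_topology (\<lambda>_. weak_topology) UNIV)
              (\<lambda>T t. if t \<le> T then policy_prod (\<pi>T T t) (\<mu>T T t) else \<nu>) z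
          \<longrightarrow> (\<exists>\<pi> \<mu>. avg_TRMFE c p lam \<rho> \<Omega> Qterm \<pi> \<mu> \<and>
                (\<forall>t. z t = policy_prod (\<pi> t) (\<mu> t)))))"
proof (intro conjI impI allI ballI)
  interpret regularized_mfg c p lam \<rho> \<Omega> L\<^sub>1 K\<^sub>1
    using assms by unfold_locales
  show "\<exists>\<pi> \<mu>. avg_TRMFE c p lam \<rho> \<Omega> Qterm \<pi> \<mu>" if "Qterm \<in> C_alpha c \<rho> \<Omega> \<omega> \<alpha> L\<^sub>1 K\<^sub>1" for Qterm
    using that avg_TRMFE_exists by (auto simp: C_alpha_def)
  have \<omega>: "\<And>x a. 1 \<le> \<omega> x a"
    using assms(2) by (simp add: minorization_drift_def)
  fix Qterm QT \<mu>init \<nu> z and \<pi>T :: "nat \<Rightarrow> nat \<Rightarrow> 'x \<Rightarrow> 'a pmf measure" and \<mu>T :: "nat \<Rightarrow> nat \<Rightarrow> 'x pmf"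
  let ?s = "\<lambda>T t. if t \<le> T then policy_prod (\<pi>T T t) (\<mu>T T t) else \<nu>"
  assume "Qterm \<in> C_alpha c \<rho> \<Omega> \<omega> \<alpha> L\<^sub>1 K\<^sub>1
    \<and> (\<forall>T. QT T \<in> C_alpha c \<rho> \<Omega> \<omega> \<alpha> L\<^sub>1 K\<^sub>1)
    \<and> (\<lambda>T. Q_norm \<omega> (\<lambda>x u. QT T x u - Qterm x u)) \<longlonglongrightarrow> 0
    \<and> (\<forall>T. avg_finite_MFE c p lam \<rho> \<Omega> T \<mu>init (QT T) (\<pi>T T) (\<mu>T T))
    \<and> \<nu> \<in> space (prob_algebra state_control_space)
    \<and> accumulation_point (product_topology (\<lambda>_. weak_topology) UNIV) ?s z"
  then have Qterm: "Qterm \<in> C_alpha c \<rho> \<Omega> \<omega> \<alpha> L\<^sub>1 K\<^sub>1"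
    and QT: "\<And>T. QT T \<in> C_alpha c \<rho> \<Omega> \<omega> \<alpha> L\<^sub>1 K\<^sub>1"
    and lim: "(\<lambda>T. Q_norm \<omega> (\<lambda>x u. QT T x u - Qterm x u)) \<longlonglongrightarrow> 0"
    and MFE: "\<And>T. avg_finite_MFE c p lam \<rho> \<Omega> T \<mu>init (QT T) (\<pi>T T) (\<mu>T T)"
    and acc: "accumulation_point (product_topology (\<lambda>_. weak_topology) UNIV) ?s z"
    by auto
  obtain q where q: "Qterm = reg_Q \<rho> \<Omega> q" using Qterm by (auto simp: C_alpha_def)
  have "\<exists>qT. QT T = reg_Q \<rho> \<Omega> qT" for T using QT[of T] by (auto simp: C_alpha_def)
  then obtain qT where qT: "\<And>T. QT T = reg_Q \<rho> \<Omega> (qT T)" by metis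
  note MFE_control = avg_finite_MFE_control[OF MFE[unfolded qT]]
  obtain F where F: "F \<noteq> bot" "F \<le> sequentially"
    and z: "\<And>t. z t \<in> space (prob_algebra state_control_space)"
    and conv: "\<And>t (f :: _ \<Rightarrow> real). (\<And>x. continuous_on UNIV (\<lambda>u. f (x, u))) \<Longrightarrow> bounded (range f) \<Longrightarrow>
      ((\<lambda>T. \<integral>w. f w \<partial>?s T t) \<longlongrightarrow> (\<integral>w. f w \<partial>z t)) F"
    by (rule accumulation_point_weakE[OF acc]) (rule that; blast)
  \<comment> \<open>For fixed \<open>t\<close>, eventually \<open>t \<le> T\<close>, so the padding
    \<open>\<nu>\<close> disappears along \<open>F\<close>.\<close>
  have s: "\<forall>\<^sub>F T in F. ?s T t = policy_prod (\<lambda>x. return borel (control (qT T) (\<mu>T T) t x)) (\<mu>T T t)" for t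
    using filter_leD[OF F(2) eventually_ge_at_top[of t]]
    by eventually_elim (simp add: MFE_control(1))
  have ind: "continuous_on UNIV (\<lambda>u. indicator {x} (fst (y, u)) :: real)"
    "bounded (range (\<lambda>w. indicator {x} (fst w) :: real))" for x y
    by (auto simp: indicator_def intro!: boundedI[of _ 1])
  \<comment> \<open>An accumulation point comes without state measures; its first marginals supply
    the candidates.\<close>
  have "\<exists>m. \<forall>x. pmf m x = (\<integral>w. indicator {x} (fst w) \<partial>z t)" for t
  proof (rule pmf_exists)
    interpret prob_space "z t" using z[of t] by (simp add: space_prob_algebra)
    have meas: "(\<lambda>w. indicator {x} (fst w) :: real) \<in> borel_measurable (z t)" for x
      using measurable_state_control[OF ind(1)] z[of t]
      by (simp add: space_prob_algebra cong: measurable_cong_sets)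
    have "integrable (z t) (\<lambda>w. indicator {x} (fst w) :: real)" for x
      using meas by (intro integrable_const_bound[of _ 1]) (auto simp: indicator_def)
    then have "(\<Sum>x\<in>UNIV. \<integral>w. indicator {x} (fst w) \<partial>z t) = (\<integral>w. (\<Sum>x\<in>UNIV. indicator {x} (fst w) :: real) \<partial>z t)"
      by simp
    also have "\<dots> = (\<integral>w. 1 \<partial>z t)"
      by (simp add: indicator_def)
    finally show "(\<Sum>x\<in>UNIV. \<integral>w. indicator {x} (fst w) \<partial>z t) = (1::real)"
      by (simp add: prob_space)
  qed simp
  then obtain \<mu> where \<mu>: "\<And>t x. pmf (\<mu> t) x = (\<integral>w. indicator {x} (fst w) \<partial>z t)" by metis
  have \<mu>T: "((\<lambda>T. \<mu>T T t) \<longlongrightarrow> \<mu> t) F" for t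
    unfolding tendsto_pmf_iff
  proof
    fix x
    have "\<forall>\<^sub>F T in F. (\<integral>w. indicator {x} (fst w) \<partial>?s T t) = pmf (\<mu>T T t) x"
      using s[of t]
    proof eventually_elim
      case (elim T)
      show ?case unfolding elim
        by (subst integral_policy_prod_return[OF ind(1)]) (simp add: indicator_def if_distrib[of "\<lambda>r. r * _"] cong: if_cong)
    qed
    then show "((\<lambda>T. pmf (\<mu>T T t) x) \<longlongrightarrow> pmf (\<mu> t) x) F"
      unfolding \<mu> by (rule Lim_transform_eventually[OF conv[OF ind]])
  qed
  have q_lim: "((\<lambda>T. qT T x a) \<longlongrightarrow> q x a) F" for x a
  proof (rule LIM_zero_cancel, rule Lim_null_comparison)
    show "\<forall>\<^sub>F T in F. norm (qT T x a - q x a) \<le> \<omega> x a * Q_norm \<omega> (\<lambda>x u. QT T x u - Qterm x u)"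
      unfolding q qT real_norm_def by (intro always_eventually allI Q_norm_reg_Q_pointwise[OF \<omega>])
    show "((\<lambda>T. \<omega> x a * Q_norm \<omega> (\<lambda>x u. QT T x u - Qterm x u)) \<longlongrightarrow> 0) F"
      using tendsto_mult_left[OF tendsto_mono[OF F(2) lim], of "\<omega> x a"] by simp
  qed
  note control_lim = tendsto_control[of qT q, OF q_lim \<mu>T]
  have "z t = policy_prod (\<lambda>x. return borel (control q \<mu> t x)) (\<mu> t)" for t
    by (rule weak_limit_eq_policy_prod[OF F(1) z conv s control_lim \<mu>T])
  \<comment> \<open>Both sides are limits of \<open>\<mu>T T t\<close> along \<open>F\<close>: the
    left by convergence of the marginals, the right through the evolution equation, valid for
    \<open>t < T\<close>.\<close>
  moreover have "\<mu> t = flow (control q \<mu> (Suc t)) (\<mu> (Suc t))" for t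
  proof (rule tendsto_unique[OF F(1) \<mu>T])
    have "\<forall>\<^sub>F T in F. flow (control (qT T) (\<mu>T T) (Suc t)) (\<mu>T T (Suc t)) = \<mu>T T t"
      using filter_leD[OF F(2) eventually_gt_at_top[of t]]
      by eventually_elim (rule MFE_control(2)[symmetric])
    then show "((\<lambda>T. \<mu>T T t) \<longlongrightarrow> flow (control q \<mu> (Suc t)) (\<mu> (Suc t))) F"
      by (rule Lim_transform_eventually[OF tendsto_flow[OF control_lim \<mu>T]])
  qed
  ultimately show "\<exists>\<pi> \<mu>. avg_TRMFE c p lam \<rho> \<Omega> Qterm \<pi> \<mu> \<and> (\<forall>t. z t = policy_prod (\<pi> t) (\<mu> t))"
    unfolding q using avg_TRMFE_control by blast
qed

end
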